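(* Let $\mathsf{SDS}$ be the category of weighted dual skeletons, $\times$ the Cartesian product of skeletons (on objects and on morphisms), and $\mathcal I$ the skeleton with exactly one site (a fixed point of the involution) with weight $\kappa=1$. Then $(\mathsf{SDS},\times,\mathcal I)$ is a symmetric monoidal category, where the natural isomorphisms of associativity, left and right unit, and commutativity $$\alpha_{\mathcal E_1,\mathcal E_2,\mathcal E_3}:(\mathcal E_1\times\mathcal E_2)\times\mathcal E_3\to\mathcal E_1\times(\mathcal E_2\times\mathcal E_3),\quad \lambda_{\mathcal E}:\mathcal I\times\mathcal E\to\mathcal E,\quad \rho_{\mathcal E}:\mathcal E\times\mathcal I\to\mathcal E,\quad \gamma_{\mathcal E_1,\mathcal E_2}:\mathcal E_1\times\mathcal E_2\to\mathcal E_2\times\mathcal E_1$$ are induced by the canonical bijections of the underlying sets of sites, which preserve involutions and weights.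
   Context: A weighted dual skeleton is a triple $\mathcal E=(Z,\sigma,\kappa)$ where $Z$ is a non-empty finite set (of sites), $\sigma:Z\to Z$ satisfies $\sigma^2=\mathrm{id}$, and $\kappa:Z\to\mathbb R_{>0}$ satisfies $\kappa(z)\kappa(\sigma(z))=K$ for all $z\in Z$, with $K>0$ a constant independent of $z$. A morphism $\phi:(Z_1,\sigma_1,\kappa_1)\to(Z_2,\sigma_2,\kappa_2)$ is a map $\phi:Z_1\to Z_2$ with $\phi(\sigma_1(z))=\sigma_2(\phi(z))$ and $\kappa_1(z)=\kappa_2(\phi(z))$ for all $z\in Z_1$. Composition and identities are those of maps of sets; the resulting category is $\mathsf{SDS}$. The Cartesian product of $\mathcal E_i=(Z_i,\sigma_i,\kappa_i)$, $i=1,2$, is $\mathcal E_1\times\mathcal E_2=(Z_1\times Z_2,\sigma_1\times\sigma_2,\kappa_1\otimes\kappa_2)$ with $(\sigma_1\times\sigma_2)(z,w)=(\sigma_1(z),\sigma_2(w))$ and $(\kappa_1\otimes\kappa_2)(z,w)=\kappa_1(z)\kappa_2(w)$. For morphisms $\phi_i:\mathcal E_i\to\mathcal E_i'$, $(\phi_1\times\phi_2)(z,w)=(\phi_1(z),\phi_2(w))$. *)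

theory Defs
  imports Complex_Main "HOL-Library.FuncSet"
begin

section \<open>Categories\<close>

record ('o, 'm) cat =
  Obj :: "'o set"
  Arr :: "'m set"
  Dom :: "'m \<Rightarrow> 'o"
  Cod :: "'m \<Rightarrow> 'o"
  Ident :: "'o \<Rightarrow> 'm"
  Comp :: "'m \<Rightarrow> 'm \<Rightarrow> 'm"  (* Comp C g f is "g after f", constrained only for Cod f = Dom g *)

definition Hom :: "('o, 'm) cat \<Rightarrow> 'o \<Rightarrow> 'o \<Rightarrow> 'm set" where
  "Hom C A B = {f \<in> Arr C. Dom C f = A \<and> Cod C f = B}"

locale category =
  fixes C :: "('o, 'm) cat"
  assumes Dom_in: "f \<in> Arr C \<Longrightarrow> Dom C f \<in> Obj C"
    and Cod_in: "f \<in> Arr C \<Longrightarrow> Cod C f \<in> Obj C"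
    and Ident_in: "A \<in> Obj C \<Longrightarrow> Ident C A \<in> Hom C A A"
    and Comp_in: "f \<in> Hom C A B \<Longrightarrow> g \<in> Hom C B D \<Longrightarrow> Comp C g f \<in> Hom C A D"
    and Comp_Ident_left: "f \<in> Hom C A B \<Longrightarrow> Comp C (Ident C B) f = f"
    and Comp_Ident_right: "f \<in> Hom C A B \<Longrightarrow> Comp C f (Ident C A) = f"
    and Comp_assoc: "f \<in> Hom C A B \<Longrightarrow> g \<in> Hom C B D \<Longrightarrow> h \<in> Hom C D E
      \<Longrightarrow> Comp C h (Comp C g f) = Comp C (Comp C h g) f"

definition is_iso :: "('o, 'm) cat \<Rightarrow> 'o \<Rightarrow> 'o \<Rightarrow> 'm \<Rightarrow> bool" where
  "is_iso C A B f \<longleftrightarrow> f \<in> Hom C A B \<and>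
     (\<exists>g \<in> Hom C B A. Comp C g f = Ident C A \<and> Comp C f g = Ident C B)"

definition prod_cat :: "('o, 'm) cat \<Rightarrow> ('p, 'n) cat \<Rightarrow> ('o \<times> 'p, 'm \<times> 'n) cat" where
  "prod_cat C D = \<lparr>Obj = Obj C \<times> Obj D, Arr = Arr C \<times> Arr D,
     Dom = map_prod (Dom C) (Dom D), Cod = map_prod (Cod C) (Cod D),
     Ident = map_prod (Ident C) (Ident D),
     Comp = (\<lambda>(g, g') (f, f'). (Comp C g f, Comp D g' f'))\<rparr>"

locale cat_functor = source: category C + target: category D
  for C :: "('o, 'm) cat" and D :: "('p, 'n) cat" +
  fixes Fo :: "'o \<Rightarrow> 'p" and Fa :: "'m \<Rightarrow> 'n"
  assumes Fo_in: "A \<in> Obj C \<Longrightarrow> Fo A \<in> Obj D"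
    and Fa_in: "f \<in> Hom C A B \<Longrightarrow> Fa f \<in> Hom D (Fo A) (Fo B)"
    and Fa_Ident: "A \<in> Obj C \<Longrightarrow> Fa (Ident C A) = Ident D (Fo A)"
    and Fa_Comp: "f \<in> Hom C A B \<Longrightarrow> g \<in> Hom C B E
      \<Longrightarrow> Fa (Comp C g f) = Comp D (Fa g) (Fa f)"

locale natural_isomorphism = F: cat_functor C D Fo Fa + G: cat_functor C D Go Ga
  for C :: "('o, 'm) cat" and D :: "('p, 'n) cat" and Fo Fa Go Ga +
  fixes \<eta> :: "'o \<Rightarrow> 'n"
  assumes component_iso: "A \<in> Obj C \<Longrightarrow> is_iso D (Fo A) (Go A) (\<eta> A)"
    and naturality: "f \<in> Hom C A B \<Longrightarrow> Comp D (\<eta> B) (Fa f) = Comp D (Ga f) (\<eta> A)"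

section \<open>Symmetric monoidal categories\<close>

locale monoidal_category =
  category C +
  tensor: cat_functor "prod_cat C C" C "case_prod To" "case_prod Ta" +
  associator: natural_isomorphism "prod_cat (prod_cat C C) C" C
    "\<lambda>((A, B), D). To (To A B) D" "\<lambda>((f, g), h). Ta (Ta f g) h"
    "\<lambda>((A, B), D). To A (To B D)" "\<lambda>((f, g), h). Ta f (Ta g h)"
    "\<lambda>((A, B), D). \<alpha> A B D" +
  left_unitor: natural_isomorphism C C "\<lambda>A. To I A" "\<lambda>f. Ta (Ident C I) f" "\<lambda>A. A" "\<lambda>f. f" \<ll> +
  right_unitor: natural_isomorphism C C "\<lambda>A. To A I" "\<lambda>f. Ta f (Ident C I)" "\<lambda>A. A" "\<lambda>f. f" \<rr>
  for C :: "('o, 'm) cat"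
    and To :: "'o \<Rightarrow> 'o \<Rightarrow> 'o" and Ta :: "'m \<Rightarrow> 'm \<Rightarrow> 'm" and I :: 'o
    and \<alpha> :: "'o \<Rightarrow> 'o \<Rightarrow> 'o \<Rightarrow> 'm" and \<ll> :: "'o \<Rightarrow> 'm" and \<rr> :: "'o \<Rightarrow> 'm" +
  assumes unit_in: "I \<in> Obj C"
    and triangle: "A \<in> Obj C \<Longrightarrow> B \<in> Obj C
      \<Longrightarrow> Comp C (Ta (Ident C A) (\<ll> B)) (\<alpha> A I B) = Ta (\<rr> A) (Ident C B)"
    and pentagon: "A \<in> Obj C \<Longrightarrow> B \<in> Obj C \<Longrightarrow> D \<in> Obj C \<Longrightarrow> E \<in> Obj C
      \<Longrightarrow> Comp C (\<alpha> A B (To D E)) (\<alpha> (To A B) D E)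
        = Comp C (Ta (Ident C A) (\<alpha> B D E))
            (Comp C (\<alpha> A (To B D) E) (Ta (\<alpha> A B D) (Ident C E)))"

locale symmetric_monoidal_category =
  monoidal_category C To Ta I \<alpha> \<ll> \<rr> +
  symmetry: natural_isomorphism "prod_cat C C" C
    "\<lambda>(A, B). To A B" "\<lambda>(f, g). Ta f g" "\<lambda>(A, B). To B A" "\<lambda>(f, g). Ta g f"
    "\<lambda>(A, B). \<gamma> A B"
  for C :: "('o, 'm) cat" and To Ta I \<alpha> \<ll> \<rr> and \<gamma> :: "'o \<Rightarrow> 'o \<Rightarrow> 'm" +
  assumes symmetry_inverse: "A \<in> Obj C \<Longrightarrow> B \<in> Obj C
      \<Longrightarrow> Comp C (\<gamma> B A) (\<gamma> A B) = Ident C (To A B)"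
    and symmetry_unit: "A \<in> Obj C \<Longrightarrow> Comp C (\<ll> A) (\<gamma> A I) = \<rr> A"
    and hexagon: "A \<in> Obj C \<Longrightarrow> B \<in> Obj C \<Longrightarrow> D \<in> Obj C
      \<Longrightarrow> Comp C (\<alpha> B D A) (Comp C (\<gamma> A (To B D)) (\<alpha> A B D))
        = Comp C (Ta (Ident C B) (\<gamma> A D))
            (Comp C (\<alpha> B A D) (Ta (\<gamma> A B) (Ident C D)))"

section \<open>Weighted dual skeletons\<close>

text \<open>
  The involution and the weight are functions on the set of sites. They are represented by
  total functions that are \<^const>\<open>undefined\<close> off that set, so that equality of skeletons
  is equality of the triples.
\<close>

record 'z skeleton =
  sites :: "'z set"
  invol :: "'z \<Rightarrow> 'z"
  weight :: "'z \<Rightarrow> real"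

definition weighted_dual_skeleton :: "'z skeleton \<Rightarrow> bool" where
  "weighted_dual_skeleton E \<longleftrightarrow>
     finite (sites E) \<and> sites E \<noteq> {} \<and>
     invol E \<in> sites E \<rightarrow>\<^sub>E sites E \<and> (\<forall>z \<in> sites E. invol E (invol E z) = z) \<and>
     weight E \<in> sites E \<rightarrow>\<^sub>E {0<..} \<and>
     (\<exists>K > 0. \<forall>z \<in> sites E. weight E z * weight E (invol E z) = K)"

definition skeleton_map :: "'z skeleton \<Rightarrow> 'w skeleton \<Rightarrow> ('z \<Rightarrow> 'w) \<Rightarrow> bool" where
  "skeleton_map E F \<phi> \<longleftrightarrow> \<phi> \<in> sites E \<rightarrow> sites F \<and>
     (\<forall>z \<in> sites E. \<phi> (invol E z) = invol F (\<phi> z) \<and> weight E z = weight F (\<phi> z))"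

record 'z skeleton_arrow =
  source :: "'z skeleton"
  target :: "'z skeleton"
  fn :: "'z \<Rightarrow> 'z"

text \<open>
  A category in HOL has one type of objects, so all sites have to come from one type that is
  closed under ordered pairs. We take the free one over an arbitrary type \<open>'a\<close> of atoms:
  every finite set in every type then occurs, via \<open>Atom\<close>, as a set of sites, and
  \<open>Tuple z w\<close> is the ordered pair of \<open>z\<close> and \<open>w\<close>.
\<close>

datatype 'a site = Atom 'a | Tuple "'a site" "'a site"

definition SDS :: "('a site skeleton, 'a site skeleton_arrow) cat" where
  "SDS = \<lparr>
     Obj = Collect weighted_dual_skeleton,
     Arr = {f. weighted_dual_skeleton (source f) \<and> weighted_dual_skeleton (target f) \<and>
               skeleton_map (source f) (target f) (fn f) \<and> fn f \<in> extensional (sites (source f))},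
     Dom = source,
     Cod = target,
     Ident = (\<lambda>E. \<lparr>source = E, target = E, fn = \<lambda>z \<in> sites E. z\<rparr>),
     Comp = (\<lambda>g f. \<lparr>source = source f, target = target g,
                     fn = \<lambda>z \<in> sites (source f). fn g (fn f z)\<rparr>)\<rparr>"

definition site_prod :: "'a site set \<Rightarrow> 'a site set \<Rightarrow> 'a site set" where
  "site_prod Z W = {Tuple z w | z w. z \<in> Z \<and> w \<in> W}"

definition skeleton_prod :: "'a site skeleton \<Rightarrow> 'a site skeleton \<Rightarrow> 'a site skeleton" where
  "skeleton_prod E F = \<lparr>
     sites = site_prod (sites E) (sites F),
     invol = (\<lambda>x \<in> site_prod (sites E) (sites F).
       case x of Tuple z w \<Rightarrow> Tuple (invol E z) (invol F w)),
     weight = (\<lambda>x \<in> site_prod (sites E) (sites F).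
       case x of Tuple z w \<Rightarrow> weight E z * weight F w)\<rparr>"

definition arrow_prod ::
    "'a site skeleton_arrow \<Rightarrow> 'a site skeleton_arrow \<Rightarrow> 'a site skeleton_arrow" where
  "arrow_prod f g = \<lparr>
     source = skeleton_prod (source f) (source g),
     target = skeleton_prod (target f) (target g),
     fn = (\<lambda>x \<in> site_prod (sites (source f)) (sites (source g)).
       case x of Tuple z w \<Rightarrow> Tuple (fn f z) (fn g w))\<rparr>"

definition unit_skeleton :: "'z \<Rightarrow> 'z skeleton" where
  "unit_skeleton p = \<lparr>sites = {p}, invol = (\<lambda>z \<in> {p}. p), weight = (\<lambda>z \<in> {p}. 1)\<rparr>"

definition sds_assoc ::
    "'a site skeleton \<Rightarrow> 'a site skeleton \<Rightarrow> 'a site skeleton \<Rightarrow> 'a site skeleton_arrow" where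
  "sds_assoc E F G = \<lparr>
     source = skeleton_prod (skeleton_prod E F) G,
     target = skeleton_prod E (skeleton_prod F G),
     fn = (\<lambda>x \<in> site_prod (site_prod (sites E) (sites F)) (sites G).
       case x of Tuple (Tuple z w) v \<Rightarrow> Tuple z (Tuple w v))\<rparr>"

definition sds_lunit :: "'a site \<Rightarrow> 'a site skeleton \<Rightarrow> 'a site skeleton_arrow" where
  "sds_lunit p E = \<lparr>source = skeleton_prod (unit_skeleton p) E, target = E,
     fn = (\<lambda>x \<in> site_prod {p} (sites E). case x of Tuple _ z \<Rightarrow> z)\<rparr>"

definition sds_runit :: "'a site \<Rightarrow> 'a site skeleton \<Rightarrow> 'a site skeleton_arrow" where
  "sds_runit p E = \<lparr>source = skeleton_prod E (unit_skeleton p), target = E,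
     fn = (\<lambda>x \<in> site_prod (sites E) {p}. case x of Tuple z _ \<Rightarrow> z)\<rparr>"

definition sds_swap ::
    "'a site skeleton \<Rightarrow> 'a site skeleton \<Rightarrow> 'a site skeleton_arrow" where
  "sds_swap E F = \<lparr>source = skeleton_prod E F, target = skeleton_prod F E,
     fn = (\<lambda>x \<in> site_prod (sites E) (sites F). case x of Tuple z w \<Rightarrow> Tuple w z)\<rparr>"

definition induced_by_bijection :: "'z skeleton_arrow \<Rightarrow> bool" where
  "induced_by_bijection f \<longleftrightarrow>
     bij_betw (fn f) (sites (source f)) (sites (target f)) \<and>
     skeleton_map (source f) (target f) (fn f)"

end

theory Submission
  imports Defs
begin

text \<open>
  Finite products of sets already make the category of sets symmetric monoidal, and an arrow of
  \<^const>\<open>SDS\<close> is a map of sets with extra properties. Two arrows with the same source and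
  target agree as soon as they agree at each site (\<open>arrow_eqI\<close>), so naturality, the triangle,
  the pentagon, the hexagon and the other coherence equations need only be checked at a tuple
  of sites, where both sides compute to the same tuple.

  What belongs to skeletons is the following. A product of skeletons is a skeleton,
  because the constant of the product is the product of the two constants
  (\<open>weighted_dual_skeleton_prod\<close>). The canonical bijections preserve involutions, which act
  coordinatewise, and they preserve weights because multiplication of positive reals is
  associative and commutative with unit \<open>1\<close>. Finally, the inverse of a bijective arrow is
  again an arrow (\<open>is_iso_if_induced_by_bijection\<close>), so a canonical bijection is an
  isomorphism as soon as it preserves involutions and weights itself.
\<close>

section \<open>Products of categories\<close>

lemma prod_cat_sel [simp]:
  "Obj (prod_cat C D) = Obj C \<times> Obj D"
  "Arr (prod_cat C D) = Arr C \<times> Arr D"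
  "Dom (prod_cat C D) (f, f') = (Dom C f, Dom D f')"
  "Cod (prod_cat C D) (f, f') = (Cod C f, Cod D f')"
  "Ident (prod_cat C D) (A, A') = (Ident C A, Ident D A')"
  "Comp (prod_cat C D) (g, g') (f, f') = (Comp C g f, Comp D g' f')"
  by (simp_all add: prod_cat_def)

lemma Hom_prod_cat [simp]: "Hom (prod_cat C D) (A, A') (B, B') = Hom C A B \<times> Hom D A' B'"
  by (auto simp: Hom_def)

lemma category_prod_cat:
  assumes "category C" "category D"
  shows "category (prod_cat C D)"
proof -
  interpret C: category C by fact
  interpret D: category D by fact
  show ?thesis
  proof
    fix f A B g E h F
    assume "f \<in> Hom (prod_cat C D) A B" "g \<in> Hom (prod_cat C D) B E" "h \<in> Hom (prod_cat C D) E F"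
    then show "Comp (prod_cat C D) h (Comp (prod_cat C D) g f)
      = Comp (prod_cat C D) (Comp (prod_cat C D) h g) f"
      by (cases A; cases B; cases E; cases F) (auto intro: C.Comp_assoc D.Comp_assoc)
  next
    fix f A B g E
    assume "f \<in> Hom (prod_cat C D) A B" "g \<in> Hom (prod_cat C D) B E"
    then show "Comp (prod_cat C D) g f \<in> Hom (prod_cat C D) A E"
      by (cases A; cases B; cases E) (auto intro: C.Comp_in D.Comp_in)
  next
    fix f A B
    assume "f \<in> Hom (prod_cat C D) A B"
    then show "Comp (prod_cat C D) (Ident (prod_cat C D) B) f = f"
      and "Comp (prod_cat C D) f (Ident (prod_cat C D) A) = f"
      by (cases A; cases B; auto intro: C.Comp_Ident_left D.Comp_Ident_left
            C.Comp_Ident_right D.Comp_Ident_right)+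
  qed (auto intro: C.Dom_in D.Dom_in C.Cod_in D.Cod_in C.Ident_in D.Ident_in)
qed

section \<open>The category of weighted dual skeletons\<close>

lemma Obj_SDS [simp]: "E \<in> Obj SDS \<longleftrightarrow> weighted_dual_skeleton E"
  by (simp add: SDS_def)

lemma Hom_SDS: "f \<in> Hom SDS E F \<longleftrightarrow>
    source f = E \<and> target f = F \<and> weighted_dual_skeleton E \<and> weighted_dual_skeleton F \<and>
    skeleton_map E F (fn f) \<and> fn f \<in> extensional (sites E)"
  by (auto simp: Hom_def SDS_def)

lemma source_target_SDS [simp]:
  "source (Ident SDS E) = E" "target (Ident SDS E) = E"
  "source (Comp SDS g f) = source f" "target (Comp SDS g f) = target g"
  by (simp_all add: SDS_def)

lemma fn_SDS [simp]:
  "z \<in> sites E \<Longrightarrow> fn (Ident SDS E) z = z"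
  "z \<in> sites (source f) \<Longrightarrow> fn (Comp SDS g f) z = fn g (fn f z)"
  by (simp_all add: SDS_def)

text \<open>
  The domain is a variable subject to an equation, so that the simplifier can
  reduce the sites of a composite or of a product of skeletons before it compares domains.
\<close>

lemma extensional_fn_SDS [simp]:
  "sites E = Z \<Longrightarrow> fn (Ident SDS E) \<in> extensional Z"
  "sites (source f) = Z \<Longrightarrow> fn (Comp SDS g f) \<in> extensional Z"
  by (auto simp: SDS_def)

lemma fn_in_sites: "f \<in> Hom SDS E F \<Longrightarrow> z \<in> sites E \<Longrightarrow> fn f z \<in> sites F"
  by (auto simp: Hom_SDS skeleton_map_def)

text \<open>
  For a composite of canonical arrows, the conditions on source, target and extensionality hold
  by unfolding. Hom-set membership of the two sides would instead require naming each
  intermediate object of the composite.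
\<close>

lemma arrow_eqI:
  fixes f g :: "'z skeleton_arrow"
  assumes "source f = source g" "target f = target g"
    and "fn f \<in> extensional (sites (source g))" "fn g \<in> extensional (sites (source g))"
    and "\<forall>z \<in> sites (source g). fn f z = fn g z"
  shows "f = g"
proof -
  have "fn f = fn g"
    using assms(3-5) by (auto intro: extensionalityI)
  with assms(1,2) show ?thesis by simp
qed

lemma skeleton_map_comp:
  "skeleton_map E F \<phi> \<Longrightarrow> skeleton_map F G \<psi> \<Longrightarrow> skeleton_map E G (\<psi> \<circ> \<phi>)"
  by (auto simp: skeleton_map_def)

lemma invol_in_sites: "weighted_dual_skeleton E \<Longrightarrow> z \<in> sites E \<Longrightarrow> invol E z \<in> sites E"
  by (auto simp: weighted_dual_skeleton_def)

lemma skeleton_map_cong: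
  assumes "weighted_dual_skeleton E" "\<And>z. z \<in> sites E \<Longrightarrow> \<phi> z = \<psi> z"
  shows "skeleton_map E F \<phi> \<longleftrightarrow> skeleton_map E F \<psi>"
  using assms invol_in_sites[OF assms(1)] by (auto simp: skeleton_map_def Pi_def)

lemma Ident_in_Hom_SDS: "weighted_dual_skeleton E \<Longrightarrow> Ident SDS E \<in> Hom SDS E E"
  by (auto simp: Hom_SDS skeleton_map_def invol_in_sites)

lemma Comp_in_Hom_SDS:
  assumes f: "f \<in> Hom SDS E F" and g: "g \<in> Hom SDS F G"
  shows "Comp SDS g f \<in> Hom SDS E G"
proof -
  have "skeleton_map E G (fn g \<circ> fn f)"
    using f g by (auto simp: Hom_SDS intro: skeleton_map_comp)
  moreover have "skeleton_map E G (fn (Comp SDS g f)) \<longleftrightarrow> skeleton_map E G (fn g \<circ> fn f)"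
    using f by (intro skeleton_map_cong) (auto simp: Hom_SDS)
  ultimately show ?thesis
    using f g by (simp add: Hom_SDS)
qed

lemma category_SDS: "category (SDS :: ('a site skeleton, 'a site skeleton_arrow) cat)"
proof
  fix f :: "'a site skeleton_arrow" and E F
  assume f: "f \<in> Hom SDS E F"
  then show "Comp SDS (Ident SDS F) f = f" "Comp SDS f (Ident SDS E) = f"
    using fn_in_sites[OF f]
    by (auto simp: Hom_SDS intro!: arrow_eqI)
next
  fix f g h :: "'a site skeleton_arrow" and E F G H
  assume f: "f \<in> Hom SDS E F" and g: "g \<in> Hom SDS F G" and h: "h \<in> Hom SDS G H"
  show "Comp SDS h (Comp SDS g f) = Comp SDS (Comp SDS h g) f"
    using f g h fn_in_sites[OF f]
    by (intro arrow_eqI) (auto simp: Hom_SDS)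
qed (auto simp: Ident_in_Hom_SDS intro: Comp_in_Hom_SDS, auto simp: SDS_def)

text \<open>
  The inverse map commutes with the involutions and preserves weights because every site of
  the target is the image of a site of the source, for which the map itself does so.
\<close>

lemma is_iso_if_induced_by_bijection:
  assumes E: "weighted_dual_skeleton E" and F: "weighted_dual_skeleton F"
    and st: "source f = E" "target f = F" and ext: "fn f \<in> extensional (sites E)"
    and ind: "induced_by_bijection f"
  shows "is_iso SDS E F f"
proof -
  have bij: "bij_betw (fn f) (sites E) (sites F)" and map: "skeleton_map E F (fn f)"
    using ind st by (auto simp: induced_by_bijection_def)
  define g where
    "g = \<lparr>source = F, target = E, fn = restrict (inv_into (sites E) (fn f)) (sites F)\<rparr>"
  have g_f: "fn g (fn f z) = z" if "z \<in> sites E" for z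
    using bij that by (auto simp: g_def bij_betw_def)
  have onto: "sites F = fn f ` sites E"
    using bij by (simp add: bij_betw_def)
  have "skeleton_map F E (fn g)"
    unfolding skeleton_map_def
  proof (intro conjI ballI Pi_I)
    fix w assume "w \<in> sites F"
    then obtain z where z: "z \<in> sites E" "w = fn f z"
      using onto by auto
    have "invol F w = fn f (invol E z)"
      using map z by (simp add: skeleton_map_def)
    then show "fn g (invol F w) = invol E (fn g w)"
      using z invol_in_sites[OF E] by (simp add: g_f)
    show "weight F w = weight E (fn g w)" "fn g w \<in> sites E"
      using map z by (simp_all add: g_f skeleton_map_def)
  qed
  then have g: "g \<in> Hom SDS F E"
    using E F by (simp add: Hom_SDS g_def)
  have f: "f \<in> Hom SDS E F"
    using E F st ext map by (simp add: Hom_SDS)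
  have sg: "source g = F" "target g = E"
    by (simp_all add: g_def)
  have f_g: "fn f (fn g w) = w" if "w \<in> sites F" for w
    using that g_f by (auto simp: onto)
  have "Comp SDS g f = Ident SDS E"
    using st sg by (intro arrow_eqI) (simp_all add: g_f)
  moreover have "Comp SDS f g = Ident SDS F"
    using st sg by (intro arrow_eqI) (simp_all add: f_g)
  ultimately show ?thesis
    using f g by (auto simp: is_iso_def)
qed

section \<open>The Cartesian product of skeletons\<close>

lemma Tuple_in_site_prod [simp]: "Tuple z w \<in> site_prod Z W \<longleftrightarrow> z \<in> Z \<and> w \<in> W"
  by (auto simp: site_prod_def)

lemma ball_site_prod [simp]:
  "(\<forall>x \<in> site_prod Z W. P x) \<longleftrightarrow> (\<forall>z \<in> Z. \<forall>w \<in> W. P (Tuple z w))"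
  by (auto simp: site_prod_def)

lemma site_prodE [elim!]:
  assumes "x \<in> site_prod Z W"
  obtains z w where "x = Tuple z w" "z \<in> Z" "w \<in> W"
  using assms by (auto simp: site_prod_def)

lemma site_prod_eq_image: "site_prod Z W = case_prod Tuple ` (Z \<times> W)"
  by (auto simp: site_prod_def)

lemma skeleton_prod_sel [simp]:
  "sites (skeleton_prod E F) = site_prod (sites E) (sites F)"
  "z \<in> sites E \<Longrightarrow> w \<in> sites F \<Longrightarrow>
    invol (skeleton_prod E F) (Tuple z w) = Tuple (invol E z) (invol F w)"
  "z \<in> sites E \<Longrightarrow> w \<in> sites F \<Longrightarrow>
    weight (skeleton_prod E F) (Tuple z w) = weight E z * weight F w"
  by (simp_all add: skeleton_prod_def)

lemma unit_skeleton_sel [simp]: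
  "sites (unit_skeleton p) = {p}" "invol (unit_skeleton p) p = p" "weight (unit_skeleton p) p = 1"
  by (simp_all add: unit_skeleton_def)

lemma weighted_dual_skeleton_unit [simp]: "weighted_dual_skeleton (unit_skeleton p)"
  by (auto simp: weighted_dual_skeleton_def unit_skeleton_def)

text \<open>
  If \<open>K\<close> and \<open>L\<close> are the constants of the factors, regrouping the four weights shows that
  \<open>K * L\<close> is one for the product.
\<close>

lemma weighted_dual_skeleton_prod [simp]:
  assumes E: "weighted_dual_skeleton E" and F: "weighted_dual_skeleton F"
  shows "weighted_dual_skeleton (skeleton_prod E F)"
proof -
  obtain K where K: "K > 0" "\<And>z. z \<in> sites E \<Longrightarrow> weight E z * weight E (invol E z) = K"
    using E unfolding weighted_dual_skeleton_def by blast
  obtain L where L: "L > 0" "\<And>w. w \<in> sites F \<Longrightarrow> weight F w * weight F (invol F w) = L"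
    using F unfolding weighted_dual_skeleton_def by blast
  have const_eq: "weight E z * weight F w * (weight E (invol E z) * weight F (invol F w)) = K * L"
    if "z \<in> sites E" "w \<in> sites F" for z w
    using K(2)[OF that(1)] L(2)[OF that(2)] by (metis mult.assoc mult.left_commute)
  have "\<exists>M > 0. \<forall>x \<in> sites (skeleton_prod E F).
      weight (skeleton_prod E F) x * weight (skeleton_prod E F) (invol (skeleton_prod E F) x) = M"
    using K(1) L(1) E F
    by (intro exI[of _ "K * L"]) (simp add: const_eq invol_in_sites)
  moreover have "invol (skeleton_prod E F)
      \<in> sites (skeleton_prod E F) \<rightarrow>\<^sub>E sites (skeleton_prod E F)"
    using E F by (auto simp: skeleton_prod_def site_prod_def invol_in_sites)
  moreover have "weight (skeleton_prod E F) \<in> sites (skeleton_prod E F) \<rightarrow>\<^sub>E {0<..}"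
    using E F by (auto simp: skeleton_prod_def site_prod_def weighted_dual_skeleton_def
        intro!: mult_pos_pos)
  moreover have "finite (sites (skeleton_prod E F))" "sites (skeleton_prod E F) \<noteq> {}"
    using E F by (auto simp: weighted_dual_skeleton_def site_prod_eq_image)
  ultimately show ?thesis
    using E F by (simp add: weighted_dual_skeleton_def[of "skeleton_prod E F"])
      (auto simp: invol_in_sites, auto simp: weighted_dual_skeleton_def)
qed

lemma arrow_prod_sel [simp]:
  "source (arrow_prod f g) = skeleton_prod (source f) (source g)"
  "target (arrow_prod f g) = skeleton_prod (target f) (target g)"
  "z \<in> sites (source f) \<Longrightarrow> w \<in> sites (source g) \<Longrightarrow>
    fn (arrow_prod f g) (Tuple z w) = Tuple (fn f z) (fn g w)"
  "sites (source f) = Z \<Longrightarrow> sites (source g) = W \<Longrightarrow>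
    fn (arrow_prod f g) \<in> extensional (site_prod Z W)"
  by (auto simp: arrow_prod_def)

lemma arrow_prod_in_Hom:
  assumes "f \<in> Hom SDS E E'" "g \<in> Hom SDS F F'"
  shows "arrow_prod f g \<in> Hom SDS (skeleton_prod E F) (skeleton_prod E' F')"
proof -
  have st: "source f = E" "target f = E'" "source g = F" "target g = F'"
    and wds: "weighted_dual_skeleton E" "weighted_dual_skeleton E'"
      "weighted_dual_skeleton F" "weighted_dual_skeleton F'"
    using assms by (auto simp: Hom_SDS)
  have "skeleton_map (skeleton_prod E F) (skeleton_prod E' F') (fn (arrow_prod f g))"
    using assms st wds unfolding skeleton_map_def Pi_iff
    by (simp add: Hom_SDS invol_in_sites fn_in_sites[OF assms(1)] fn_in_sites[OF assms(2)])
      (auto simp: skeleton_map_def Pi_iff)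
  then show ?thesis
    using st wds by (simp add: Hom_SDS)
qed

lemma arrow_prod_Ident:
  "arrow_prod (Ident SDS E) (Ident SDS F) = Ident SDS (skeleton_prod E F)"
  by (intro arrow_eqI) auto

lemma arrow_prod_Comp:
  assumes f: "f \<in> Hom SDS E F" and f': "f' \<in> Hom SDS E' F'"
    and g: "g \<in> Hom SDS F G" and g': "g' \<in> Hom SDS F' G'"
  shows "arrow_prod (Comp SDS g f) (Comp SDS g' f')
    = Comp SDS (arrow_prod g g') (arrow_prod f f')"
  using assms fn_in_sites[OF f] fn_in_sites[OF f']
  by (intro arrow_eqI) (auto simp: Hom_SDS)

text \<open>
  Tensoring with the identity of a fixed object respects composition, because that identity is
  its own composite with itself.
\<close>

lemma arrow_prod_Comp_Ident:
  assumes "f \<in> Hom SDS E F" "g \<in> Hom SDS F G" "weighted_dual_skeleton D"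
  shows "arrow_prod (Ident SDS D) (Comp SDS g f)
      = Comp SDS (arrow_prod (Ident SDS D) g) (arrow_prod (Ident SDS D) f)"
    and "arrow_prod (Comp SDS g f) (Ident SDS D)
      = Comp SDS (arrow_prod g (Ident SDS D)) (arrow_prod f (Ident SDS D))"
proof -
  note D = Ident_in_Hom_SDS[OF assms(3)]
  have DD: "Comp SDS (Ident SDS D) (Ident SDS D) = Ident SDS D"
    using category.Comp_Ident_left[OF category_SDS D] .
  show "arrow_prod (Ident SDS D) (Comp SDS g f)
      = Comp SDS (arrow_prod (Ident SDS D) g) (arrow_prod (Ident SDS D) f)"
    using arrow_prod_Comp[OF D assms(1) D assms(2)] by (simp add: DD)
  show "arrow_prod (Comp SDS g f) (Ident SDS D)
      = Comp SDS (arrow_prod g (Ident SDS D)) (arrow_prod f (Ident SDS D))"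
    using arrow_prod_Comp[OF assms(1) D assms(2) D] by (simp add: DD)
qed

section \<open>The canonical bijections\<close>

lemma sds_assoc_sel [simp]:
  "source (sds_assoc E F G) = skeleton_prod (skeleton_prod E F) G"
  "target (sds_assoc E F G) = skeleton_prod E (skeleton_prod F G)"
  "z \<in> sites E \<Longrightarrow> w \<in> sites F \<Longrightarrow> v \<in> sites G \<Longrightarrow>
    fn (sds_assoc E F G) (Tuple (Tuple z w) v) = Tuple z (Tuple w v)"
  "fn (sds_assoc E F G) \<in> extensional (site_prod (site_prod (sites E) (sites F)) (sites G))"
  by (simp_all add: sds_assoc_def)

lemma sds_lunit_sel [simp]:
  "source (sds_lunit p E) = skeleton_prod (unit_skeleton p) E" "target (sds_lunit p E) = E"
  "z \<in> sites E \<Longrightarrow> fn (sds_lunit p E) (Tuple p z) = z"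
  "fn (sds_lunit p E) \<in> extensional (site_prod {p} (sites E))"
  by (simp_all add: sds_lunit_def)

lemma sds_runit_sel [simp]:
  "source (sds_runit p E) = skeleton_prod E (unit_skeleton p)" "target (sds_runit p E) = E"
  "z \<in> sites E \<Longrightarrow> fn (sds_runit p E) (Tuple z p) = z"
  "fn (sds_runit p E) \<in> extensional (site_prod (sites E) {p})"
  by (simp_all add: sds_runit_def)

lemma sds_swap_sel [simp]:
  "source (sds_swap E F) = skeleton_prod E F" "target (sds_swap E F) = skeleton_prod F E"
  "z \<in> sites E \<Longrightarrow> w \<in> sites F \<Longrightarrow> fn (sds_swap E F) (Tuple z w) = Tuple w z"
  "fn (sds_swap E F) \<in> extensional (site_prod (sites E) (sites F))"
  by (simp_all add: sds_swap_def)

lemma induced_by_bijection_sds_assoc: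
  assumes "weighted_dual_skeleton E" "weighted_dual_skeleton F" "weighted_dual_skeleton G"
  shows "induced_by_bijection (sds_assoc E F G)"
  unfolding induced_by_bijection_def
proof
  show "bij_betw (fn (sds_assoc E F G))
      (sites (source (sds_assoc E F G))) (sites (target (sds_assoc E F G)))"
    by (rule bij_betw_byWitness[where f' = "\<lambda>x. case x of Tuple z (Tuple w v) \<Rightarrow> Tuple (Tuple z w) v"])
      (auto simp: image_subset_iff)
  show "skeleton_map (source (sds_assoc E F G)) (target (sds_assoc E F G)) (fn (sds_assoc E F G))"
    using assms by (simp add: skeleton_map_def Pi_iff invol_in_sites)
qed

lemma induced_by_bijection_sds_lunit:
  assumes "weighted_dual_skeleton E"
  shows "induced_by_bijection (sds_lunit p E)"
  unfolding induced_by_bijection_def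
proof
  show "bij_betw (fn (sds_lunit p E)) (sites (source (sds_lunit p E))) (sites (target (sds_lunit p E)))"
    by (rule bij_betw_byWitness[where f' = "Tuple p"]) (auto simp: image_subset_iff)
  show "skeleton_map (source (sds_lunit p E)) (target (sds_lunit p E)) (fn (sds_lunit p E))"
    using assms by (simp add: skeleton_map_def Pi_iff invol_in_sites)
qed

lemma induced_by_bijection_sds_runit:
  assumes "weighted_dual_skeleton E"
  shows "induced_by_bijection (sds_runit p E)"
  unfolding induced_by_bijection_def
proof
  show "bij_betw (fn (sds_runit p E)) (sites (source (sds_runit p E))) (sites (target (sds_runit p E)))"
    by (rule bij_betw_byWitness[where f' = "\<lambda>z. Tuple z p"]) (auto simp: image_subset_iff)
  show "skeleton_map (source (sds_runit p E)) (target (sds_runit p E)) (fn (sds_runit p E))"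
    using assms by (simp add: skeleton_map_def Pi_iff invol_in_sites)
qed

lemma induced_by_bijection_sds_swap:
  assumes "weighted_dual_skeleton E" "weighted_dual_skeleton F"
  shows "induced_by_bijection (sds_swap E F)"
  unfolding induced_by_bijection_def
proof
  show "bij_betw (fn (sds_swap E F)) (sites (source (sds_swap E F))) (sites (target (sds_swap E F)))"
    by (rule bij_betw_byWitness[where f' = "\<lambda>x. case x of Tuple w z \<Rightarrow> Tuple z w"])
      (auto simp: image_subset_iff)
  show "skeleton_map (source (sds_swap E F)) (target (sds_swap E F)) (fn (sds_swap E F))"
    using assms by (simp add: skeleton_map_def Pi_iff invol_in_sites mult.commute)
qed

lemmas canonical_is_iso =
  is_iso_if_induced_by_bijection[OF _ _ _ _ _ induced_by_bijection_sds_assoc]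
  is_iso_if_induced_by_bijection[OF _ _ _ _ _ induced_by_bijection_sds_lunit]
  is_iso_if_induced_by_bijection[OF _ _ _ _ _ induced_by_bijection_sds_runit]
  is_iso_if_induced_by_bijection[OF _ _ _ _ _ induced_by_bijection_sds_swap]

section \<open>The symmetric monoidal structure\<close>

lemma natural_isomorphismI:
  assumes "cat_functor C D Fo Fa" "cat_functor C D Go Ga"
    and "\<And>A. A \<in> Obj C \<Longrightarrow> is_iso D (Fo A) (Go A) (\<eta> A)"
    and "\<And>f A B. f \<in> Hom C A B \<Longrightarrow> Comp D (\<eta> B) (Fa f) = Comp D (Ga f) (\<eta> A)"
  shows "natural_isomorphism C D Fo Fa Go Ga \<eta>"
  using assms by (simp add: natural_isomorphism_def natural_isomorphism_axioms_def)

lemma cat_functor_SDS_I: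
  assumes "category C"
    and "\<And>A. A \<in> Obj C \<Longrightarrow> weighted_dual_skeleton (Fo A)"
    and "\<And>f A B. f \<in> Hom C A B \<Longrightarrow> Fa f \<in> Hom SDS (Fo A) (Fo B)"
    and "\<And>A. A \<in> Obj C \<Longrightarrow> Fa (Ident C A) = Ident SDS (Fo A)"
    and "\<And>f g A B E. f \<in> Hom C A B \<Longrightarrow> g \<in> Hom C B E \<Longrightarrow>
      Fa (Comp C g f) = Comp SDS (Fa g) (Fa f)"
  shows "cat_functor C SDS Fo Fa"
  using assms category_SDS by (simp add: cat_functor_def cat_functor_axioms_def)

lemmas category_SDS2 = category_prod_cat[OF category_SDS category_SDS]
lemmas category_SDS3 = category_prod_cat[OF category_SDS2 category_SDS]

lemma functor_id: "cat_functor SDS SDS (\<lambda>E. E) (\<lambda>f. f)"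
  by (intro cat_functor_SDS_I category_SDS) auto

lemma functor_prod: "cat_functor (prod_cat SDS SDS) SDS (case_prod skeleton_prod) (case_prod arrow_prod)"
  by (intro cat_functor_SDS_I category_SDS2)
    (auto simp: arrow_prod_Ident intro: arrow_prod_in_Hom arrow_prod_Comp)

lemma functor_prod_flip:
  "cat_functor (prod_cat SDS SDS) SDS (\<lambda>(E, F). skeleton_prod F E) (\<lambda>(f, g). arrow_prod g f)"
  by (intro cat_functor_SDS_I category_SDS2)
    (auto simp: arrow_prod_Ident intro: arrow_prod_in_Hom arrow_prod_Comp)

text \<open>
  For iterated products the interchange law \<open>arrow_prod_Comp\<close> is used at both levels; at the
  outer level one of the two arrows is itself a product.
\<close>

lemma functor_prod_left:
  "cat_functor (prod_cat (prod_cat SDS SDS) SDS) SDS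
    (\<lambda>((E, F), G). skeleton_prod (skeleton_prod E F) G)
    (\<lambda>((f, g), h). arrow_prod (arrow_prod f g) h)"
  by (intro cat_functor_SDS_I category_SDS3)
    (auto simp: arrow_prod_Ident arrow_prod_Comp
      intro!: arrow_prod_in_Hom arrow_prod_Comp[OF arrow_prod_in_Hom _ arrow_prod_in_Hom])

lemma functor_prod_right:
  "cat_functor (prod_cat (prod_cat SDS SDS) SDS) SDS
    (\<lambda>((E, F), G). skeleton_prod E (skeleton_prod F G))
    (\<lambda>((f, g), h). arrow_prod f (arrow_prod g h))"
  by (intro cat_functor_SDS_I category_SDS3)
    (auto simp: arrow_prod_Ident arrow_prod_Comp
      intro!: arrow_prod_in_Hom arrow_prod_Comp[OF _ arrow_prod_in_Hom _ arrow_prod_in_Hom])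

lemma functor_prod_Ident:
  assumes "weighted_dual_skeleton D"
  shows "cat_functor SDS SDS (\<lambda>E. skeleton_prod D E) (\<lambda>f. arrow_prod (Ident SDS D) f)"
    and "cat_functor SDS SDS (\<lambda>E. skeleton_prod E D) (\<lambda>f. arrow_prod f (Ident SDS D))"
  using assms
  by (auto intro!: cat_functor_SDS_I category_SDS arrow_prod_in_Hom Ident_in_Hom_SDS
      simp: arrow_prod_Ident arrow_prod_Comp_Ident)

text \<open>
  In the triangle both sides send \<open>((a, p), b)\<close> to \<open>(a, b)\<close>; in the pentagon both send
  \<open>(((a, b), d), e)\<close> to \<open>(a, (b, (d, e)))\<close>. Naturality uses that an arrow sends sites of its source to sites of its target,
  since the canonical bijections are unspecified elsewhere.
\<close>

lemma monoidal_category_SDS: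
  "monoidal_category SDS skeleton_prod arrow_prod (unit_skeleton p)
     sds_assoc (sds_lunit p) (sds_runit p)"
proof -
  have assoc: "natural_isomorphism (prod_cat (prod_cat SDS SDS) SDS) SDS
    (\<lambda>((E, F), G). skeleton_prod (skeleton_prod E F) G)
    (\<lambda>((f, g), h). arrow_prod (arrow_prod f g) h)
    (\<lambda>((E, F), G). skeleton_prod E (skeleton_prod F G))
    (\<lambda>((f, g), h). arrow_prod f (arrow_prod g h))
    (\<lambda>((E, F), G). sds_assoc E F G)"
    by (intro natural_isomorphismI functor_prod_left functor_prod_right)
      (auto intro!: canonical_is_iso arrow_eqI simp: Hom_SDS skeleton_map_def Pi_iff)
  have lunit: "natural_isomorphism SDS SDS (\<lambda>E. skeleton_prod (unit_skeleton p) E)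
      (\<lambda>f. arrow_prod (Ident SDS (unit_skeleton p)) f) (\<lambda>E. E) (\<lambda>f. f) (sds_lunit p)"
    by (intro natural_isomorphismI functor_prod_Ident functor_id)
      (auto intro!: canonical_is_iso arrow_eqI simp: Hom_SDS skeleton_map_def Pi_iff)
  have runit: "natural_isomorphism SDS SDS (\<lambda>E. skeleton_prod E (unit_skeleton p))
      (\<lambda>f. arrow_prod f (Ident SDS (unit_skeleton p))) (\<lambda>E. E) (\<lambda>f. f) (sds_runit p)"
    by (intro natural_isomorphismI functor_prod_Ident functor_id)
      (auto intro!: canonical_is_iso arrow_eqI simp: Hom_SDS skeleton_map_def Pi_iff)
  show ?thesis
    unfolding monoidal_category_def monoidal_category_axioms_def
    by (intro conjI category_SDS functor_prod assoc lunit runit) (auto intro!: arrow_eqI)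
qed

text \<open>
  Both sides of the hexagon send \<open>((a, b), d)\<close> to \<open>(b, (d, a))\<close>.
\<close>

lemma symmetric_monoidal_category_SDS:
  "symmetric_monoidal_category SDS skeleton_prod arrow_prod (unit_skeleton p)
     sds_assoc (sds_lunit p) (sds_runit p) sds_swap"
proof -
  have swap: "natural_isomorphism (prod_cat SDS SDS) SDS
    (\<lambda>(E, F). skeleton_prod E F) (\<lambda>(f, g). arrow_prod f g)
    (\<lambda>(E, F). skeleton_prod F E) (\<lambda>(f, g). arrow_prod g f) (\<lambda>(E, F). sds_swap E F)"
    by (intro natural_isomorphismI functor_prod functor_prod_flip)
      (auto intro!: canonical_is_iso arrow_eqI simp: Hom_SDS skeleton_map_def Pi_iff)
  show ?thesis
    unfolding symmetric_monoidal_category_def symmetric_monoidal_category_axioms_def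
    by (intro conjI monoidal_category_SDS swap) (auto intro!: arrow_eqI)
qed

theorem theorem6p3:
  fixes p :: "'a site"
  shows "symmetric_monoidal_category SDS skeleton_prod arrow_prod (unit_skeleton p)
           sds_assoc (sds_lunit p) (sds_runit p) sds_swap
       \<and> (\<forall>E \<in> Obj SDS. \<forall>F \<in> Obj SDS. \<forall>G \<in> Obj SDS.
             induced_by_bijection (sds_assoc E F G :: 'a site skeleton_arrow))
       \<and> (\<forall>E \<in> Obj SDS. induced_by_bijection (sds_lunit p E))
       \<and> (\<forall>E \<in> Obj SDS. induced_by_bijection (sds_runit p E))
       \<and> (\<forall>E \<in> Obj SDS. \<forall>F \<in> Obj SDS.
             induced_by_bijection (sds_swap E F :: 'a site skeleton_arrow))"
  using symmetric_monoidal_category_SDS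
  by (auto simp: induced_by_bijection_sds_assoc induced_by_bijection_sds_lunit
      induced_by_bijection_sds_runit induced_by_bijection_sds_swap)

end
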